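(* There is a unimodular lattice $L$ in dimension $41$ having minimum norm $4$ with $\sigma(L)=17$.
   Context: A (Euclidean) lattice $L \subset \mathbb{R}^n$ in dimension $n$ (i.e. of full rank $n$) is unimodular if $L=L^*$, where $L^*=\{x\in\mathbb{R}^n \mid (x,y)\in\mathbb{Z}\text{ for all }y\in L\}$ and $(x,y)$ is the standard inner product. The norm of a vector $x$ is $(x,x)$ (the squared length), and the minimum norm $\min(L)$ is the smallest norm of a nonzero vector of $L$. A unimodular lattice is even if all its vectors have even norm, and odd otherwise; even unimodular lattices exist only in dimensions divisible by $8$, so a unimodular lattice in dimension $41$ is odd. For an odd unimodular lattice $L$, the even sublattice is $L_0=\{x\in L\mid (x,x)\in 2\mathbb{Z}\}$, the shadow is $S(L)=L_0^*\setminus L$, and $\sigma(L)=4\min(S(L))$, where $\min(S(L))$ is the minimum norm of a vector in $S(L)$. *)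

theory Defs
  imports "HOL-Analysis.Analysis"
begin

definition full_rank_lattice :: "(real ^ 'n) set \<Rightarrow> bool" where
  "full_rank_lattice L \<longleftrightarrow>
     (\<exists>B. independent B \<and> span B = UNIV \<and>
          L = {\<Sum>b\<in>B. of_int (c b) *\<^sub>R b | c :: real ^ 'n \<Rightarrow> int. True})"

definition dual_lattice :: "(real ^ 'n) set \<Rightarrow> (real ^ 'n) set" where
  "dual_lattice L = {x. \<forall>y\<in>L. x \<bullet> y \<in> \<int>}"

definition unimodular_lattice :: "(real ^ 'n) set \<Rightarrow> bool" where
  "unimodular_lattice L \<longleftrightarrow> full_rank_lattice L \<and> L = dual_lattice L"

text \<open>The norm of a vector is its squared length \<open>x \<bullet> x\<close>, not the Euclidean length \<open>norm x\<close>.\<close>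

definition min_norm :: "(real ^ 'n) set \<Rightarrow> real" where
  "min_norm L = (LEAST m. \<exists>x\<in>L. x \<noteq> 0 \<and> m = x \<bullet> x)"

definition even_sublattice :: "(real ^ 'n) set \<Rightarrow> (real ^ 'n) set" where
  "even_sublattice L = {x \<in> L. \<exists>k::int. x \<bullet> x = 2 * of_int k}"

text \<open>The shadow and its invariant \<open>\<sigma>\<close> are meant for odd unimodular lattices. An even
  unimodular lattice has empty shadow under this definition, so its \<open>\<sigma>\<close> is unspecified; this does
  not occur unless \<open>8\<close> divides the dimension.\<close>

definition shadow :: "(real ^ 'n) set \<Rightarrow> (real ^ 'n) set" where
  "shadow L = dual_lattice (even_sublattice L) - L"

definition sigma_shadow :: "(real ^ 'n) set \<Rightarrow> real" where
  "sigma_shadow L = 4 * (LEAST m. \<exists>x\<in>shadow L. m = x \<bullet> x)"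

end

theory Submission
  imports Defs
begin

text \<open>Let \<open>C\<close> be a self-dual code over \<open>\<int>\<^sub>4\<close> of length \<open>41\<close> whose (doubly even) residue
  code \<open>R\<close> has all nonzero weights between \<open>16\<close> and \<open>28\<close> and whose torsion code, the dual of
  \<open>R\<close>, has minimum weight at least \<open>4\<close>. The lattice \<open>L\<close> of all \<open>x / 2\<close> with \<open>x\<close> an integer vector
  reducing into \<open>C\<close> is unimodular. If \<open>x\<close> has an odd entry, it has at least \<open>16\<close> of them and \<open>x / 2\<close>
  has norm at least \<open>4\<close>; otherwise \<open>x / 2\<close> is an integer vector reducing into the torsion code, and
  its norm is again at least \<open>4\<close>.

  The shadow of \<open>L\<close> consists of the vectors \<open>w / 2\<close> with \<open>w\<close> characteristic. Testing against the
  torsion code shows that \<open>w\<close> is an integer vector which modulo \<open>2\<close> lies in \<open>1 + R\<close>, so it has at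
  least \<open>41 - 28 = 13\<close> odd entries. Since \<open>(w, w)\<close> is congruent to \<open>41\<close> modulo \<open>8\<close>, it is at least
  \<open>17\<close>, and an explicit \<open>w\<close> of norm \<open>17\<close> exists.\<close>

section \<open>Bases of lattices\<close>

definition int_span :: "(real ^ 'n) set \<Rightarrow> (real ^ 'n) set" where
  "int_span B = {\<Sum>b\<in>B. of_int (c b) *\<^sub>R b | c :: real ^ 'n \<Rightarrow> int. True}"

lemma int_spanI: "(\<Sum>b\<in>B. of_int (c b) *\<^sub>R b) \<in> int_span B"
  by (auto simp: int_span_def)

lemma int_span_base:
  assumes "finite B" "b \<in> B"
  shows "b \<in> int_span B"
proof -
  have "(\<Sum>x\<in>B. of_int (of_bool (x = b)) *\<^sub>R x) = (\<Sum>x\<in>B. if x = b then b else 0)"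
    by (intro sum.cong) auto
  then show ?thesis
    using assms int_spanI[of "\<lambda>x. of_bool (x = b)" B] by simp
qed

lemma subgroup_of_int_scaleR:
  fixes L :: "(real ^ 'n) set"
  assumes "0 \<in> L" and diff: "\<And>x y. x \<in> L \<Longrightarrow> y \<in> L \<Longrightarrow> x - y \<in> L" and "x \<in> L"
  shows "of_int z *\<^sub>R x \<in> L"
proof -
  have uminus: "- y \<in> L" if "y \<in> L" for y
    using diff[OF \<open>0 \<in> L\<close> that] by simp
  have nat: "of_nat n *\<^sub>R x \<in> L" for n
  proof (induction n)
    case (Suc n)
    then show ?case
      using diff[OF Suc uminus[OF \<open>x \<in> L\<close>]] by (simp add: algebra_simps)
  qed (simp add: \<open>0 \<in> L\<close>)
  show ?thesis
    using nat uminus by (cases z rule: int_cases2) simp_all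
qed

lemma int_span_subset_subgroup:
  assumes "0 \<in> L" and diff: "\<And>x y. x \<in> L \<Longrightarrow> y \<in> L \<Longrightarrow> x - y \<in> L" and "B \<subseteq> L"
  shows "int_span B \<subseteq> L"
proof -
  have add: "x + y \<in> L" if "x \<in> L" "y \<in> L" for x y
    using diff[OF that(1) diff[OF \<open>0 \<in> L\<close> that(2)]] by simp
  have "(\<Sum>b\<in>B. of_int (c b) *\<^sub>R b) \<in> L" for c
    using \<open>B \<subseteq> L\<close>
    by (induction B rule: infinite_finite_induct)
       (auto intro!: add subgroup_of_int_scaleR[OF \<open>0 \<in> L\<close> diff] \<open>0 \<in> L\<close>)
  then show ?thesis
    by (auto simp: int_span_def)
qed

text \<open>The induction over the coordinates is the computation of the Hermite normal form: the
  vector with the least positive \<open>i\<close>-th coordinate extends a basis of the sublattice of vectors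
  with vanishing \<open>i\<close>-th coordinate.\<close>

lemma subgroup_has_basis:
  fixes L :: "(real ^ 'n) set"
  assumes "finite S" and "m > 0"
    and "0 \<in> L" and "\<And>x y. x \<in> L \<Longrightarrow> y \<in> L \<Longrightarrow> x - y \<in> L"
    and "\<And>i. i \<in> S \<Longrightarrow> of_nat m *\<^sub>R axis i 1 \<in> L"
    and "\<And>x i. x \<in> L \<Longrightarrow> of_nat m * x $ i \<in> \<int>"
    and "\<And>x i. x \<in> L \<Longrightarrow> i \<notin> S \<Longrightarrow> x $ i = 0"
  shows "\<exists>B. finite B \<and> independent B \<and> card B = card S \<and> L = int_span B"
  using assms
proof (induction S arbitrary: L rule: finite_induct)
  case empty
  then have "L = {0}"
    by (auto simp: vec_eq_iff)
  then show ?case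
    by (intro exI[of _ "{}"]) (auto simp: int_span_def independent_empty)
next
  case (insert i S)
  note diff = insert.prems(3)
  define K where "K = {x \<in> L. x $ i = 0}"
  have "\<exists>B. finite B \<and> independent B \<and> card B = card S \<and> K = int_span B"
  proof (rule insert.IH)
    show "of_nat m *\<^sub>R axis j 1 \<in> K" if "j \<in> S" for j
      using that insert.hyps(2) insert.prems(4)[of j] by (auto simp: K_def axis_def)
    show "x - y \<in> K" if "x \<in> K" "y \<in> K" for x y
      using that diff[of x y] by (simp add: K_def)
    show "of_nat m * x $ j \<in> \<int>" if "x \<in> K" for x j
      using that insert.prems(5) by (simp add: K_def)
    show "x $ j = 0" if "x \<in> K" "j \<notin> S" for x j
      using that insert.prems(6)[of x j] by (cases "j = i") (auto simp: K_def)
  qed (use \<open>m > 0\<close> \<open>0 \<in> L\<close> in \<open>auto simp: K_def\<close>)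
  then obtain B where B: "finite B" "independent B" "card B = card S" "K = int_span B"
    by blast
  \<comment> \<open>The least positive \<open>i\<close>-th coordinate exists because all coordinates
    are multiples of \<open>1 / m\<close>.\<close>
  define P where "P n \<longleftrightarrow> n > 0 \<and> (\<exists>x\<in>L. of_nat m * x $ i = of_nat n)" for n :: nat
  have "P (m * m)"
    using \<open>m > 0\<close> insert.prems(4)[of i]
    by (auto simp: P_def axis_def intro!: bexI[of _ "of_nat m *\<^sub>R axis i 1"])
  then have P: "P (LEAST n. P n)"
    by (rule LeastI)
  define d where "d = (LEAST n. P n)"
  obtain v where v: "v \<in> L" "of_nat m * v $ i = of_nat d" and "d > 0"
    using P by (auto simp: P_def d_def)
  have scale: "of_int z *\<^sub>R x \<in> L" if "x \<in> L" for x z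
    using subgroup_of_int_scaleR[OF \<open>0 \<in> L\<close> diff that] by blast
  have "v $ i \<noteq> 0"
    using v \<open>d > 0\<close> by auto
  have "B \<subseteq> K"
    using B(1,4) by (auto intro: int_span_base)
  have "span B \<subseteq> {x. x $ i = 0}"
    using \<open>B \<subseteq> K\<close> by (intro span_minimal) (auto simp: K_def subspace_def)
  then have "v \<notin> span B"
    using \<open>v $ i \<noteq> 0\<close> by auto
  then have "v \<notin> B"
    using span_base by blast
  have "L = int_span (insert v B)"
  proof
    show "int_span (insert v B) \<subseteq> L"
    proof (rule int_span_subset_subgroup)
      show "insert v B \<subseteq> L"
        using \<open>B \<subseteq> K\<close> v(1) by (auto simp: K_def)
    qed (fact \<open>0 \<in> L\<close>, fact diff)
    show "L \<subseteq> int_span (insert v B)"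
    proof
      fix x assume "x \<in> L"
      then obtain z where z: "of_nat m * x $ i = of_int z"
        using insert.prems(5) by (metis Ints_cases)
      \<comment> \<open>Division with remainder: the remainder is below \<open>d\<close>, so
        minimality makes the \<open>i\<close>-th coordinate of \<open>y\<close> vanish and
        \<open>y\<close> falls into \<open>K\<close>.\<close>
      define y where "y = x - of_int (z div int d) *\<^sub>R v"
      have "y \<in> L"
        using \<open>x \<in> L\<close> scale[OF v(1)] diff by (simp add: y_def)
      have "of_nat m * y $ i = of_int z - of_int (z div int d) * of_nat d"
        unfolding y_def by (simp add: algebra_simps z flip: v(2))
      also have "\<dots> = of_int (z - z div int d * int d)"
        by simp
      also have "\<dots> = of_nat (nat (z mod int d))"
        using \<open>d > 0\<close> by (simp add: minus_div_mult_eq_mod)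
      finally have yi: "of_nat m * y $ i = of_nat (nat (z mod int d))" .
      have "\<not> P (nat (z mod int d))"
        using \<open>d > 0\<close> unfolding d_def[symmetric]
        by (metis P d_def nat_less_iff not_less_Least of_nat_0_less_iff pos_mod_bound pos_mod_sign)
      then have "nat (z mod int d) = 0"
        using yi \<open>y \<in> L\<close> by (auto simp: P_def)
      then have "y \<in> K"
        using yi \<open>y \<in> L\<close> \<open>m > 0\<close> by (auto simp: K_def)
      then obtain c where c: "y = (\<Sum>b\<in>B. of_int (c b) *\<^sub>R b)"
        unfolding B(4) int_span_def by auto
      have "(\<Sum>b\<in>insert v B. of_int ((c(v := z div int d)) b) *\<^sub>R b)
          = of_int (z div int d) *\<^sub>R v + (\<Sum>b\<in>B. of_int (c b) *\<^sub>R b)"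
        using B(1) \<open>v \<notin> B\<close> by (auto intro!: sum.cong)
      also have "\<dots> = x"
        unfolding c[symmetric] y_def by simp
      finally show "x \<in> int_span (insert v B)"
        using int_spanI by metis
    qed
  qed
  moreover have "independent (insert v B)"
    using B(2) \<open>v \<notin> span B\<close> by (simp add: independent_insert)
  ultimately show ?case
    using B \<open>v \<notin> B\<close> insert.hyps by (intro exI[of _ "insert v B"]) auto
qed

text \<open>Taking all coordinates in \<open>subgroup_has_basis\<close> gives a basis with as many
  vectors as the dimension, and that many independent vectors span the space.\<close>

lemma full_rank_lattice_if_subgroup:
  fixes L :: "(real ^ 'n) set"
  assumes "m > 0" "0 \<in> L" "\<And>x y. x \<in> L \<Longrightarrow> y \<in> L \<Longrightarrow> x - y \<in> L"
    and "\<And>i. of_nat m *\<^sub>R axis i 1 \<in> L" and "\<And>x i. x \<in> L \<Longrightarrow> of_nat m * x $ i \<in> \<int>"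
  shows "full_rank_lattice L"
proof -
  obtain B where B: "finite B" "independent B" "card B = CARD('n)" "L = int_span B"
    using subgroup_has_basis[of UNIV m L] assms by auto
  have "span B = UNIV"
    using B(2,3) card_ge_dim_independent[of B UNIV] by auto
  then show ?thesis
    using B unfolding full_rank_lattice_def int_span_def by blast
qed

section \<open>Integer vectors scaled by one half\<close>

definition ip :: "('n::finite \<Rightarrow> int) \<Rightarrow> ('n \<Rightarrow> int) \<Rightarrow> int" where
  "ip X Y = (\<Sum>x\<in>UNIV. X x * Y x)"

lemma ip_add_left: "ip (\<lambda>x. X x + Y x) Z = ip X Z + ip Y Z"
  and ip_diff_left: "ip (\<lambda>x. X x - Y x) Z = ip X Z - ip Y Z"
  and ip_scale_left: "ip (\<lambda>x. c * X x) Z = c * ip X Z"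
  by (simp_all add: ip_def algebra_simps sum.distrib sum_subtractf sum_distrib_left)

lemma ip_commute: "ip X Y = ip Y X"
  by (simp add: ip_def mult.commute)

lemma ip_add_right: "ip Z (\<lambda>x. X x + Y x) = ip Z X + ip Z Y"
  and ip_diff_right: "ip Z (\<lambda>x. X x - Y x) = ip Z X - ip Z Y"
  and ip_scale_right: "ip Z (\<lambda>x. c * X x) = c * ip Z X"
  by (simp_all add: ip_commute[of Z] ip_add_left ip_diff_left ip_scale_left)

lemmas ip_linear = ip_add_left ip_diff_left ip_scale_left ip_add_right ip_diff_right ip_scale_right

lemma ip_sum_right: "ip Z (\<lambda>x. \<Sum>i\<in>I. f i x) = (\<Sum>i\<in>I. ip Z (f i))"
  unfolding ip_def by (simp add: sum_distrib_left) (rule sum.swap)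

lemma sum_mult_of_bool_eq:
  fixes f :: "'a \<Rightarrow> int"
  assumes "finite A" "j \<in> A"
  shows "(\<Sum>i\<in>A. f i * of_bool (i = j)) = f j"
  using assms by (subst sum.remove[of _ j]) auto

lemma ip_ge_card:
  assumes "\<And>x. x \<in> A \<Longrightarrow> X x \<noteq> 0"
  shows "int (card A) \<le> ip X X"
proof -
  have "int (card A) = (\<Sum>x\<in>A. 1)"
    by simp
  also have "\<dots> \<le> (\<Sum>x\<in>A. X x * X x)"
    using assms by (intro sum_mono) (metis not_square_less_zero mult_eq_0_iff linorder_not_le int_one_le_iff_zero_less order_le_less)
  also have "\<dots> \<le> ip X X"
    unfolding ip_def by (rule sum_mono2) auto
  finally show ?thesis .
qed

lemma ip_ge_square: "X x * X x \<le> ip X X"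
  unfolding ip_def by (rule member_le_sum) auto

text \<open>With this scaling, integral inner products become divisibility of \<open>ip\<close> by
  4, and even norms divisibility by 8.\<close>

definition half_vec :: "('n::finite \<Rightarrow> int) \<Rightarrow> real ^ 'n" where
  "half_vec X = (\<chi> x. of_int (X x) / 2)"

lemma inner_half_vec: "half_vec X \<bullet> half_vec Y = of_int (ip X Y) / 4"
  by (simp add: half_vec_def inner_vec_def ip_def sum_divide_distrib)

lemma of_int_div_4_in_Ints_iff: "(of_int n / 4 :: real) \<in> \<int> \<longleftrightarrow> 4 dvd n"
proof
  assume "(of_int n / 4 :: real) \<in> \<int>"
  then obtain m where "(of_int n / 4 :: real) = of_int m"
    by (rule Ints_cases)
  then have "(of_int n :: real) = of_int (4 * m)"
    by simp
  then show "4 dvd n"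
    by (simp only: of_int_eq_iff dvd_triv_left)
qed auto

lemma of_int_div_4_eq_even_iff:
  "(\<exists>k::int. (of_int n / 4 :: real) = 2 * of_int k) \<longleftrightarrow> 8 dvd n"
proof
  assume "\<exists>k::int. (of_int n / 4 :: real) = 2 * of_int k"
  then obtain k :: int where "(of_int n / 4 :: real) = 2 * of_int k"
    by blast
  then have "(of_int n :: real) = of_int (8 * k)"
    by simp
  then show "8 dvd n"
    by (simp only: of_int_eq_iff dvd_triv_left)
qed auto

lemma vec_eq_half_vec:
  assumes "\<And>i. 2 * x $ i \<in> \<int>"
  shows "\<exists>X. x = half_vec X"
proof -
  have "\<forall>i. \<exists>n. 2 * x $ i = of_int n"
    using assms by (auto elim: Ints_cases)
  then obtain X where "\<And>i. 2 * x $ i = of_int (X i)"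
    by metis
  then show ?thesis
    by (auto simp: half_vec_def vec_eq_iff field_simps)
qed

section \<open>Lattices from self-dual codes over the integers modulo four\<close>

text \<open>The lattice \<open>A\<^sub>4(C)\<close> of the self-dual \<open>\<int>\<^sub>4\<close>-code \<open>C\<close> with residue code
  generated by the rows \<open>g 0, \<dots>, g (k - 1)\<close> modulo \<open>2\<close>; all vectors are scaled by \<open>2\<close>
  to stay within the integers. The positions \<open>p 0, \<dots>, p (k - 1)\<close> form an information set.\<close>

locale Z4_code =
  fixes k :: nat and g :: "nat \<Rightarrow> 'n::finite \<Rightarrow> int" and p :: "nat \<Rightarrow> 'n"
  assumes orth: "i < k \<Longrightarrow> j < k \<Longrightarrow> 4 dvd ip (g i) (g j)"
    and info: "i < k \<Longrightarrow> j < k \<Longrightarrow> g i (p j) = of_bool (i = j)"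
begin

section \<open>The code as a set of integer vectors\<close>

definition word :: "(nat \<Rightarrow> int) \<Rightarrow> 'n \<Rightarrow> int" where
  "word a x = (\<Sum>i<k. a i * g i x)"

text \<open>The integer preimage of the binary dual of the residue code.\<close>

definition torsion :: "('n \<Rightarrow> int) set" where
  "torsion = {t. \<forall>i<k. even (ip t (g i))}"

text \<open>The full integer preimage of the quaternary code; all multiples of 4 are included
  because \<open>torsion\<close> contains every even vector.\<close>

definition code :: "('n \<Rightarrow> int) set" where
  "code = {\<lambda>x. 2 * t x + word a x | t a. t \<in> torsion}"

definition lattice :: "(real ^ 'n) set" where
  "lattice = half_vec ` code"

lemma word_info: "i < k \<Longrightarrow> word a (p i) = a i"
  using sum_mult_of_bool_eq[of "{..<k}" i a] by (simp add: word_def info)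

lemma ip_word_right: "ip X (word a) = (\<Sum>i<k. a i * ip X (g i))"
  by (simp add: word_def[abs_def] ip_sum_right ip_scale_right)

lemma ip_word_word: "4 dvd ip (word a) (word b)"
  unfolding ip_word_right
  by (auto simp: ip_commute[of "word a"] ip_word_right orth intro!: dvd_sum dvd_mult)

lemma ip_torsion_word: "t \<in> torsion \<Longrightarrow> even (ip t (word a))"
  by (auto simp: torsion_def ip_word_right intro!: dvd_sum)

lemma word_unit: "i < k \<Longrightarrow> word (\<lambda>j. of_bool (j = i)) = g i"
  using sum_mult_of_bool_eq[of "{..<k}" i "\<lambda>j. g j x" for x] by (auto simp: word_def mult.commute)

lemma codeI: "t \<in> torsion \<Longrightarrow> (\<lambda>x. 2 * t x + word a x) \<in> code"
  by (auto simp: code_def)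

lemma word_zero: "word (\<lambda>_. 0) = (\<lambda>_. 0)"
  by (simp add: word_def[abs_def])

lemma zero_torsion: "(\<lambda>_. 0) \<in> torsion"
  by (simp add: torsion_def ip_def)

lemma torsion_code: "t \<in> torsion \<Longrightarrow> (\<lambda>x. 2 * t x) \<in> code"
  using codeI[of t "\<lambda>_. 0"] by (simp add: word_zero)

lemma word_code: "word a \<in> code"
  using codeI[OF zero_torsion, of a] by simp

lemma double_torsion: "(\<lambda>x. 2 * X x) \<in> torsion"
  by (simp add: torsion_def ip_linear)

lemma code_diff: "X \<in> code \<Longrightarrow> Y \<in> code \<Longrightarrow> (\<lambda>x. X x - Y x) \<in> code"
proof -
  assume "X \<in> code" "Y \<in> code"
  then obtain s a t b where X: "X = (\<lambda>x. 2 * s x + word a x)" "s \<in> torsion"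
    and Y: "Y = (\<lambda>x. 2 * t x + word b x)" "t \<in> torsion"
    by (auto simp: code_def)
  have "(\<lambda>x. X x - Y x) = (\<lambda>x. 2 * (s x - t x) + word (\<lambda>i. a i - b i) x)"
    by (simp add: X Y word_def algebra_simps sum_subtractf)
  moreover have "(\<lambda>x. s x - t x) \<in> torsion"
    using X Y by (simp add: torsion_def ip_linear)
  ultimately show ?thesis
    using codeI by metis
qed

lemma code_ip: "X \<in> code \<Longrightarrow> Y \<in> code \<Longrightarrow> 4 dvd ip X Y"
proof -
  assume "X \<in> code" "Y \<in> code"
  then obtain s a t b where X: "X = (\<lambda>x. 2 * s x + word a x)" "s \<in> torsion"
    and Y: "Y = (\<lambda>x. 2 * t x + word b x)" "t \<in> torsion"
    by (auto simp: code_def)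
  have "ip X Y = 4 * ip s t + 2 * ip s (word b) + 2 * ip t (word a) + ip (word a) (word b)"
    by (simp add: X Y ip_linear ip_commute[of "word a" t])
  moreover have "4 dvd 2 * ip s (word b)" "4 dvd 2 * ip t (word a)"
    using ip_torsion_word[OF X(2), of b] ip_torsion_word[OF Y(2), of a] by presburger+
  ultimately show ?thesis
    using ip_word_word by (simp add: dvd_add)
qed

text \<open>The \<open>x\<close>-th unit vector, made orthogonal to all generators by using the information set.\<close>

definition dual_unit :: "'n \<Rightarrow> 'n \<Rightarrow> int" where
  "dual_unit x y = of_bool (y = x) - (\<Sum>i<k. g i x * of_bool (y = p i))"

text \<open>For \<open>X\<close> vanishing on the information positions, pairing with
  \<open>dual_unit x\<close> reads off the entry \<open>X x\<close>.\<close>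

lemma ip_dual_unit:
  "ip X (dual_unit x) = X x - (\<Sum>i<k. g i x * X (p i))"
proof -
  have delta: "ip X (\<lambda>y. of_bool (y = z)) = X z" for z
    by (simp add: ip_def sum_mult_of_bool_eq)
  have "ip X (\<lambda>y. c * of_bool (y = z)) = c * X z" for c z
    by (simp only: ip_scale_right delta)
  then show ?thesis
    by (simp only: dual_unit_def[abs_def] ip_diff_right ip_sum_right delta)
qed

lemma dual_unit_torsion: "dual_unit x \<in> torsion"
proof -
  have "ip (g i) (dual_unit x) = 0" if "i < k" for i
    using that sum_mult_of_bool_eq[of "{..<k}" i "\<lambda>j. g j x"]
    by (simp add: ip_dual_unit info eq_commute)
  then show ?thesis
    by (simp add: torsion_def ip_commute[of "dual_unit x"])
qed

text \<open>Subtracting the word that agrees with \<open>X\<close> on the information positions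
  leaves \<open>Z\<close>. Pairing with the doubled \<open>dual_unit\<close> vectors makes
  \<open>Z\<close> even, and pairing with the rows puts half of it into
  \<open>torsion\<close>.\<close>

lemma code_dual:
  assumes "\<And>Y. Y \<in> code \<Longrightarrow> 4 dvd ip X Y"
  shows "X \<in> code"
proof -
  define a where "a i = X (p i)" for i
  define Z where "Z x = X x - word a x" for x
  have Z0: "Z (p i) = 0" if "i < k" for i
    using that by (simp add: Z_def word_info a_def)
  have Z4: "4 dvd ip Z Y" if "Y \<in> code" for Y
    using assms[OF that] code_ip[OF word_code that] by (simp add: Z_def[abs_def] ip_linear)
  have "even (Z x)" for x
  proof -
    have "ip Z (\<lambda>y. 2 * dual_unit x y) = 2 * Z x"
      by (simp add: ip_scale_right ip_dual_unit Z0)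
    then have "4 dvd 2 * Z x"
      using Z4[OF torsion_code[OF dual_unit_torsion[of x]]] by metis
    then show ?thesis
      by presburger
  qed
  then have Z2: "Z x = 2 * (Z x div 2)" for x
    by simp
  then have Z: "Z = (\<lambda>x. 2 * (Z x div 2))"
    by blast
  have "(\<lambda>x. Z x div 2) \<in> torsion"
  proof -
    have "even (ip (\<lambda>x. Z x div 2) (g i))" if "i < k" for i
    proof -
      have "4 dvd ip Z (g i)"
        using Z4[OF word_code] word_unit[OF that] by metis
      moreover have "ip Z (g i) = 2 * ip (\<lambda>x. Z x div 2) (g i)"
        by (subst Z) (rule ip_scale_left)
      ultimately show ?thesis
        by presburger
    qed
    then show ?thesis
      by (simp add: torsion_def)
  qed
  moreover have "X = (\<lambda>x. 2 * (Z x div 2) + word a x)"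
    unfolding Z2[symmetric] by (simp add: Z_def)
  ultimately show ?thesis
    using codeI by metis
qed

section \<open>The lattice of the code and its unimodularity\<close>

lemma half_vec_unit: "half_vec (\<lambda>y. 2 * (2 * of_bool (y = x))) = 2 *\<^sub>R axis x 1"
  by (simp add: half_vec_def vec_eq_iff axis_def)

lemma unit_code: "(\<lambda>y. 2 * (2 * of_bool (y = x))) \<in> code"
  by (rule torsion_code) (rule double_torsion)

lemma half_vec_inj: "half_vec X = half_vec Y \<Longrightarrow> X = Y"
  by (simp add: half_vec_def vec_eq_iff fun_eq_iff)

lemma half_vec_in_lattice_iff: "half_vec X \<in> lattice \<longleftrightarrow> X \<in> code"
  unfolding lattice_def using half_vec_inj by blast

lemma double_unit_lattice: "2 *\<^sub>R axis x 1 \<in> lattice"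
  using half_vec_in_lattice_iff unit_code half_vec_unit by metis

lemma dual_lattice: "dual_lattice lattice = lattice"
proof
  show "lattice \<subseteq> dual_lattice lattice"
    by (auto simp: dual_lattice_def lattice_def inner_half_vec of_int_div_4_in_Ints_iff code_ip)
  show "dual_lattice lattice \<subseteq> lattice"
  proof
    fix y assume y: "y \<in> dual_lattice lattice"
    \<comment> \<open>Pairing with twice a unit vector, which lies in the lattice, shows that the
      coordinates of \<open>y\<close> are half-integers.\<close>
    have "2 * y $ i \<in> \<int>" for i
      using y double_unit_lattice[of i] by (auto simp: dual_lattice_def inner_axis)
    then obtain X where X: "y = half_vec X"
      using vec_eq_half_vec by blast
    have "4 dvd ip X Y" if "Y \<in> code" for Y
      using y that
      by (auto simp: X dual_lattice_def lattice_def inner_half_vec of_int_div_4_in_Ints_iff)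
    then show "y \<in> lattice"
      using code_dual X half_vec_in_lattice_iff by blast
  qed
qed

lemma unimodular: "unimodular_lattice lattice"
proof -
  have "full_rank_lattice lattice"
  proof (rule full_rank_lattice_if_subgroup[of 2])
    \<comment> \<open>Closure under subtraction is clear for any dual, and the lattice equals its
      own dual.\<close>
    have "x - y \<in> dual_lattice lattice"
      if "x \<in> dual_lattice lattice" "y \<in> dual_lattice lattice" for x y
      using that by (auto simp: dual_lattice_def inner_diff_left)
    then show "x - y \<in> lattice" if "x \<in> lattice" "y \<in> lattice" for x y
      using that by (simp add: dual_lattice)
    have "0 \<in> dual_lattice lattice"
      by (simp add: dual_lattice_def)
    then show "0 \<in> lattice"
      by (simp add: dual_lattice)
  qed (auto simp: double_unit_lattice, auto simp: lattice_def half_vec_def)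
  then show ?thesis
    by (simp add: unimodular_lattice_def dual_lattice)
qed

section \<open>The minimum norm\<close>

lemma even_word_torsion:
  assumes "t \<in> torsion" "\<And>i. i < k \<Longrightarrow> even (a i)"
  shows "\<exists>s\<in>torsion. (\<lambda>x. 2 * t x + word a x) = (\<lambda>x. 2 * s x)"
proof -
  define b where "b i = a i div 2" for i
  have "word a x = 2 * word b x" for x
    unfolding word_def sum_distrib_left using assms(2) by (intro sum.cong) (auto simp: b_def)
  then have "word a = (\<lambda>x. 2 * word b x)"
    by blast
  \<comment> \<open>Half of an even word is again a word, and the residue code is orthogonal to
    itself modulo 2.\<close>
  moreover have "(\<lambda>x. t x + word b x) \<in> torsion"
  proof -
    have "even (ip (word b) (g i))" if "i < k" for i
      using ip_word_word[of b "\<lambda>j. of_bool (j = i)"] word_unit[OF that]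
      by (metis dvd_trans even_numeral numeral_Bit0 dvd_triv_left mult_2)
    then show ?thesis
      using assms(1) by (simp add: torsion_def ip_linear)
  qed
  ultimately show ?thesis
    by (intro bexI[of _ "\<lambda>x. t x + word b x"]) (auto simp: algebra_simps)
qed

text \<open>An entry of absolute value at least 2 already gives norm 4. Otherwise \<open>s\<close>
  is odd on its support, and a support of at most three points would give columns summing to zero
  modulo 2, which \<open>dual_dist\<close> excludes.\<close>

lemma ip_torsion_ge:
  assumes dual_dist: "\<And>S. S \<noteq> {} \<Longrightarrow> card S \<le> 3 \<Longrightarrow> \<exists>i<k. odd (\<Sum>x\<in>S. g i x)"
    and "s \<in> torsion" "s \<noteq> (\<lambda>_. 0)"
  shows "4 \<le> ip s s"
proof (cases "\<exists>x. \<bar>s x\<bar> \<ge> 2")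
  case True
  then obtain x where "2 * 2 \<le> \<bar>s x\<bar> * \<bar>s x\<bar>"
    by (meson mult_mono abs_ge_zero zero_le_numeral order_trans)
  then have "4 \<le> s x * s x"
    by simp
  then show ?thesis
    using ip_ge_square[of s x] by linarith
next
  case False
  define S where "S = {x. s x \<noteq> 0}"
  have odd_S: "odd (s x)" if "x \<in> S" for x
  proof -
    have "\<bar>s x\<bar> < 2" "s x \<noteq> 0"
      using False that by (auto simp: S_def not_le)
    then have "s x = 1 \<or> s x = - 1"
      by arith
    then show ?thesis
      by auto
  qed
  have "S \<noteq> {}"
    using assms(3) by (auto simp: S_def)
  have "card S > 3"
  proof (rule ccontr)
    assume "\<not> card S > 3"
    then obtain i where i: "i < k" "odd (\<Sum>x\<in>S. g i x)"
      using dual_dist[OF \<open>S \<noteq> {}\<close>] by auto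
    have "ip s (g i) - (\<Sum>x\<in>S. g i x) = (\<Sum>x\<in>S. (s x - 1) * g i x)"
      unfolding ip_def
      by (subst sum.mono_neutral_right[of UNIV S]) (auto simp: S_def algebra_simps sum_subtractf)
    moreover have "even (\<Sum>x\<in>S. (s x - 1) * g i x)"
      using odd_S by (intro dvd_sum) auto
    ultimately have "odd (ip s (g i))"
      using i(2) by presburger
    then show False
      using assms(2) i(1) by (simp add: torsion_def)
  qed
  moreover have "int (card S) \<le> ip s s"
    by (rule ip_ge_card) (simp add: S_def)
  ultimately show ?thesis
    by linarith
qed

text \<open>The bound 16 is norm 4 after scaling. An odd coefficient gives at least 16 odd entries;
  if all coefficients are even, \<open>X\<close> is twice a torsion vector.\<close>

lemma ip_code_ge:
  assumes weight: "\<And>a. \<exists>i<k. odd (a i) \<Longrightarrow> 16 \<le> card {x. odd (word a x)}"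
    and dual_dist: "\<And>S. S \<noteq> {} \<Longrightarrow> card S \<le> 3 \<Longrightarrow> \<exists>i<k. odd (\<Sum>x\<in>S. g i x)"
    and "X \<in> code" "X \<noteq> (\<lambda>_. 0)"
  shows "16 \<le> ip X X"
proof -
  obtain t a where X: "X = (\<lambda>x. 2 * t x + word a x)" "t \<in> torsion"
    using \<open>X \<in> code\<close> by (auto simp: code_def)
  show ?thesis
  proof (cases "\<exists>i<k. odd (a i)")
    case True
    have "int (card {x. odd (word a x)}) \<le> ip X X"
      by (rule ip_ge_card) (metis X(1) even_add even_mult_iff even_numeral even_zero mem_Collect_eq)
    then show ?thesis
      using weight[OF True] by linarith
  next
    case False
    then obtain s where s: "s \<in> torsion" "X = (\<lambda>x. 2 * s x)"
      using even_word_torsion[OF X(2), of a] X(1) by auto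
    then have "4 \<le> ip s s"
      using ip_torsion_ge[OF dual_dist] assms(4) by (metis mult_zero_right)
    then show ?thesis
      by (simp add: s(2) ip_linear)
  qed
qed

lemma min_norm_lattice:
  assumes "\<And>a. \<exists>i<k. odd (a i) \<Longrightarrow> 16 \<le> card {x. odd (word a x)}"
    and "\<And>S. S \<noteq> {} \<Longrightarrow> card S \<le> 3 \<Longrightarrow> \<exists>i<k. odd (\<Sum>x\<in>S. g i x)"
  shows "min_norm lattice = 4"
  unfolding min_norm_def
proof (rule Least_equality)
  \<comment> \<open>Twice a unit vector attains the bound; \<open>undefined\<close> merely names
    some coordinate.\<close>
  show "\<exists>x\<in>lattice. x \<noteq> 0 \<and> 4 = x \<bullet> x"
    using double_unit_lattice
    by (intro bexI[of _ "2 *\<^sub>R axis undefined 1"]) (auto simp: inner_axis axis_eq_0_iff)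
next
  fix m :: real assume "\<exists>x\<in>lattice. x \<noteq> 0 \<and> m = x \<bullet> x"
  then obtain X where X: "X \<in> code" "half_vec X \<noteq> 0" "m = of_int (ip X X) / 4"
    by (auto simp: lattice_def inner_half_vec)
  then have "X \<noteq> (\<lambda>_. 0)"
    by (auto simp: half_vec_def vec_eq_iff)
  then have "16 \<le> ip X X"
    using ip_code_ge assms X(1) by blast
  then show "4 \<le> m"
    unfolding X(3) by linarith
qed

section \<open>Characteristic vectors and the shadow\<close>

text \<open>The condition says that \<open>2 (w, x)\<close> and \<open>(x, x)\<close> are congruent modulo \<open>2\<close> for all lattice
  vectors \<open>x\<close>, where \<open>w = half_vec W\<close>.\<close>

definition characteristic :: "('n \<Rightarrow> int) \<Rightarrow> bool" where
  "characteristic W \<longleftrightarrow> (\<forall>X\<in>code. 8 dvd 2 * ip W X - ip X X)"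

lemma half_vec_in_even_sublattice_iff:
  "half_vec X \<in> even_sublattice lattice \<longleftrightarrow> X \<in> code \<and> 8 dvd ip X X"
  unfolding even_sublattice_def mem_Collect_eq half_vec_in_lattice_iff inner_half_vec
    of_int_div_4_eq_even_iff ..

lemma half_vec_in_dual_even_sublattice_iff:
  "half_vec W \<in> dual_lattice (even_sublattice lattice) \<longleftrightarrow>
    (\<forall>X\<in>code. 8 dvd ip X X \<longrightarrow> 4 dvd ip W X)"
proof -
  have "even_sublattice lattice = half_vec ` {X \<in> code. 8 dvd ip X X}"
    using half_vec_in_even_sublattice_iff by (auto simp: even_sublattice_def lattice_def)
  then show ?thesis
    by (auto simp: dual_lattice_def inner_half_vec of_int_div_4_in_Ints_iff)
qed

lemma shadow_if_characteristic:
  assumes "characteristic W" "W \<notin> code"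
  shows "half_vec W \<in> shadow lattice"
proof -
  have "4 dvd ip W X" if "X \<in> code" "8 dvd ip X X" for X
  proof -
    have "8 dvd 2 * ip W X - ip X X"
      using assms(1) that(1) by (simp add: characteristic_def)
    then show ?thesis
      using that(2) by presburger
  qed
  then show ?thesis
    using assms(2)
    by (simp add: shadow_def half_vec_in_dual_even_sublattice_iff half_vec_in_lattice_iff)
qed

text \<open>Some \<open>Z\<close> pairs non-integrally with the shadow vector, hence has odd norm.
  As twice \<open>Z\<close> has even norm, this inner product is a proper half-integer. Any
  \<open>X\<close> of odd norm differs from \<open>Z\<close> by a vector of even norm, so it has the
  same inner product modulo 1.\<close>

lemma shadow_characteristic:
  assumes "y \<in> shadow lattice"
  shows "\<exists>W. y = half_vec W \<and> characteristic W"
proof -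
  have y: "y \<in> dual_lattice (even_sublattice lattice)" "y \<notin> lattice"
    using assms by (auto simp: shadow_def)
  have "2 *\<^sub>R axis i 1 \<in> even_sublattice lattice" for i
    using double_unit_lattice[of i]
    by (auto simp: even_sublattice_def inner_axis intro!: exI[of _ 2])
  then have "y \<bullet> (2 *\<^sub>R axis i 1) \<in> \<int>" for i
    using y(1) unfolding dual_lattice_def by blast
  then have "2 * y $ i \<in> \<int>" for i
    by (simp add: inner_axis)
  then obtain W where W: "y = half_vec W"
    using vec_eq_half_vec by blast
  have even: "4 dvd ip W X" if "X \<in> code" "8 dvd ip X X" for X
    using y(1) that by (simp add: W half_vec_in_dual_even_sublattice_iff)
  have "W \<notin> code"
    using y(2) by (simp add: W half_vec_in_lattice_iff)
  then obtain Z where Z: "Z \<in> code" "\<not> 4 dvd ip W Z"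
    using code_dual by blast
  have "8 dvd 2 * ip W X - ip X X" if X: "X \<in> code" for X
  proof (cases "8 dvd ip X X")
    case True
    then show ?thesis
      using even[OF X True] by presburger
  next
    case False
    have "4 dvd ip X X" "4 dvd ip Z Z" "4 dvd ip X Z" "\<not> 8 dvd ip Z Z"
      using X Z even code_ip by auto
    moreover have "ip (\<lambda>x. X x - Z x) (\<lambda>x. X x - Z x) = ip X X - 2 * ip X Z + ip Z Z"
      by (simp add: ip_linear ip_commute[of Z X])
    ultimately have "8 dvd ip (\<lambda>x. X x - Z x) (\<lambda>x. X x - Z x)"
      using False by presburger
    then have diff: "4 dvd ip W X - ip W Z"
      using even[OF code_diff[OF X Z(1)]] by (simp add: ip_linear)
    have "(\<lambda>_. 0) \<in> code"
      using word_code[of "\<lambda>_. 0"] by (simp only: word_zero)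
    \<comment> \<open>Twice \<open>Z\<close> is obtained as \<open>Z - (0 - Z)\<close> from closure
      under subtraction.\<close>
    from code_diff[OF Z(1) code_diff[OF this Z(1)]] have "(\<lambda>x. 2 * Z x) \<in> code"
      by (simp flip: mult_2)
    moreover have "8 dvd ip (\<lambda>x. 2 * Z x) (\<lambda>x. 2 * Z x)"
      using \<open>4 dvd ip Z Z\<close> by (simp add: ip_linear) presburger
    ultimately have "4 dvd 2 * ip W Z"
      using even[of "\<lambda>x. 2 * Z x"] by (simp add: ip_linear)
    then show ?thesis
      using diff False Z(2) \<open>4 dvd ip X X\<close> by presburger
  qed
  then show ?thesis
    using W by (auto simp: characteristic_def)
qed

text \<open>Doubled torsion vectors show that \<open>W - 1\<close> is orthogonal modulo 2 to the
  torsion code, so it lies in the residue code. The coefficients are read off on the information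
  positions, and \<open>dual_unit\<close> shows that the remainder is even everywhere.\<close>

lemma characteristic_parity:
  assumes "characteristic W"
  shows "\<exists>a. \<forall>x. odd (W x + word a x)"
proof -
  define a where "a i = W (p i) - 1" for i
  define Z where "Z x = W x - 1 - word a x" for x
  have Z0: "Z (p i) = 0" if "i < k" for i
    using that by (simp add: Z_def word_info a_def)
  have "even (ip Z t)" if t: "t \<in> torsion" for t
  proof -
    have "8 dvd 2 * ip W (\<lambda>x. 2 * t x) - ip (\<lambda>x. 2 * t x) (\<lambda>x. 2 * t x)"
      using assms torsion_code[OF t] unfolding characteristic_def by blast
    then have "even (ip W t - ip t t)"
      by (simp add: ip_linear) presburger
    moreover have "even (ip t t - ip (\<lambda>_. 1) t)"
      unfolding ip_def sum_subtractf[symmetric] by (intro dvd_sum) simp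
    moreover have "even (ip (word a) t)"
      using ip_torsion_word[OF t] by (simp add: ip_commute)
    moreover have "ip Z t = ip W t - ip (\<lambda>_. 1) t - ip (word a) t"
      by (simp add: Z_def[abs_def] ip_linear)
    ultimately show ?thesis
      by presburger
  qed
  from this[OF dual_unit_torsion] have "even (Z x)" for x
    by (simp add: ip_dual_unit Z0)
  then have "odd (W x + word a x)" for x
    unfolding Z_def by (metis (no_types, opaque_lifting) even_diff even_add odd_one)
  then show ?thesis
    by blast
qed

lemma square_minus_one_dvd_8:
  fixes n :: int
  assumes "odd n"
  shows "8 dvd n * n - 1"
proof -
  obtain m where m: "n = 2 * m + 1"
    using assms by (rule oddE)
  have "even (m * (m + 1))"
    by simp
  then obtain l where "m * (m + 1) = 2 * l"
    by (rule evenE)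
  then have "n * n - 1 = 8 * l"
    by (simp add: m algebra_simps)
  then show ?thesis
    by simp
qed

text \<open>Here \<open>W - word a\<close> has odd entries, so its norm is congruent to the dimension modulo \<open>8\<close>.\<close>

lemma characteristic_norm:
  assumes "characteristic W"
  shows "8 dvd ip W W - int CARD('n)"
proof -
  obtain a where a: "\<And>x. odd (W x + word a x)"
    using characteristic_parity[OF assms] by blast
  define V where "V x = W x - word a x" for x
  have "8 dvd (\<Sum>x\<in>UNIV. V x * V x - 1)"
    using a by (intro dvd_sum square_minus_one_dvd_8) (simp add: V_def)
  then have "8 dvd ip V V - int CARD('n)"
    by (simp add: ip_def sum_subtractf)
  moreover have "ip V V = ip W W - (2 * ip W (word a) - ip (word a) (word a))"
    by (simp add: V_def[abs_def] ip_linear ip_commute[of "word a" W])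
  moreover have "8 dvd 2 * ip W (word a) - ip (word a) (word a)"
    using assms word_code by (simp add: characteristic_def)
  ultimately show ?thesis
    by presburger
qed

text \<open>Modulo 8 the defect \<open>2 * ip W X - ip X X\<close> is additive on
  \<open>code\<close>, so the rows and the doubled torsion vectors suffice; \<open>odd\<close>
  settles the latter.\<close>

lemma characteristicI:
  assumes odd: "\<And>x. odd (W x + word a x)"
    and gen: "\<And>i. i < k \<Longrightarrow> 8 dvd 2 * ip W (g i) - ip (g i) (g i)"
  shows "characteristic W"
  unfolding characteristic_def
proof
  fix X assume "X \<in> code"
  then obtain t b where X: "X = (\<lambda>x. 2 * t x + word b x)" "t \<in> torsion"
    by (auto simp: code_def)
  define h where "h m x = (\<Sum>i<m. b i * g i x)" for m x
  have "8 dvd 2 * ip W (h m) - ip (h m) (h m)" if "m \<le> k" for m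
    using that
  proof (induction m)
    case 0
    then show ?case
      by (simp add: h_def[abs_def] ip_def)
  next
    case (Suc m)
    have h: "h (Suc m) = (\<lambda>x. h m x + b m * g m x)"
      by (simp add: h_def[abs_def])
    have "ip (g m) (h m) = (\<Sum>i<m. b i * ip (g m) (g i))"
      by (simp add: h_def[abs_def] ip_sum_right ip_scale_right)
    then have "4 dvd ip (g m) (h m)"
      using Suc.prems by (auto intro!: dvd_sum dvd_mult orth)
    then have cross: "8 dvd 2 * (b m * ip (g m) (h m))"
      by (elim dvdE) simp
    \<comment> \<open>The defect of \<open>b m * g m\<close> differs from \<open>b m\<close> times
      that of \<open>g m\<close> by \<open>b m * (b m - 1)\<close> times a norm divisible by
      4.\<close>
    have "even (b m * (b m - 1))"
      by simp
    then have "2 * 4 dvd b m * (b m - 1) * ip (g m) (g m)"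
      using orth[of m m] Suc.prems by (intro mult_dvd_mono) auto
    then have square: "8 dvd b m * (b m - 1) * ip (g m) (g m)"
      by simp
    have lin: "8 dvd b m * (2 * ip W (g m) - ip (g m) (g m))"
      using gen[of m] Suc.prems by (simp add: dvd_mult)
    have "2 * ip W (h (Suc m)) - ip (h (Suc m)) (h (Suc m))
        = (2 * ip W (h m) - ip (h m) (h m)) + b m * (2 * ip W (g m) - ip (g m) (g m))
          - b m * (b m - 1) * ip (g m) (g m) - 2 * (b m * ip (g m) (h m))"
      by (simp add: h ip_linear ip_commute[of "h m" "g m"] algebra_simps)
    then show ?case
      using Suc cross square lin by (simp only: dvd_add dvd_diff Suc_leD)
  qed
  then have word: "8 dvd 2 * ip W (word b) - ip (word b) (word b)"
    by (simp add: h_def[abs_def] word_def[abs_def])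
  \<comment> \<open>Each summand is even: if \<open>t x\<close> is odd, then the other factor is a
    difference of two odd numbers.\<close>
  have "even (\<Sum>x\<in>UNIV. (W x + word a x - t x) * t x)"
  proof (rule dvd_sum)
    show "even ((W x + word a x - t x) * t x)" for x
      using odd[of x] by (cases "even (t x)") auto
  qed
  moreover have "(\<Sum>x\<in>UNIV. (W x + word a x - t x) * t x) = ip W t + ip t (word a) - ip t t"
    by (simp add: ip_def algebra_simps sum.distrib sum_subtractf)
  moreover have "even (ip t (word a))" "even (ip t (word b))"
    using ip_torsion_word[OF X(2)] by blast+
  moreover have "2 * ip W X - ip X X
      = 4 * (ip W t - ip t t) - 4 * ip t (word b) + (2 * ip W (word b) - ip (word b) (word b))"
    by (simp add: X(1) ip_linear ip_commute[of "word b" t])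
  ultimately show "8 dvd 2 * ip W X - ip X X"
    using word by presburger
qed

lemma sigma_shadow_lattice:
  assumes dim: "CARD('n) = 41"
    and weight: "\<And>a. card {x. odd (word a x)} \<le> 28"
    and W: "characteristic W" "ip W W = 17"
  shows "sigma_shadow lattice = 17"
proof -
  have "(LEAST m. \<exists>x\<in>shadow lattice. m = x \<bullet> x) = 17 / 4"
  proof (rule Least_equality)
    \<comment> \<open>All norms in \<open>code\<close> are multiples of 4, and 17 is not.\<close>
    have "W \<notin> code"
      using code_ip[of W W] W(2) by auto
    then show "\<exists>x\<in>shadow lattice. 17 / 4 = x \<bullet> x"
      using shadow_if_characteristic[OF W(1)] W(2) by (auto simp: inner_half_vec intro!: bexI[of _ "half_vec W"])
  next
    fix m :: real assume "\<exists>x\<in>shadow lattice. m = x \<bullet> x"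
    then obtain V where V: "characteristic V" "m = of_int (ip V V) / 4"
      by (metis shadow_characteristic inner_half_vec)
    obtain a where a: "\<And>x. odd (V x + word a x)"
      using characteristic_parity[OF V(1)] by blast
    \<comment> \<open>\<open>V\<close> is odd exactly where \<open>word a\<close> is even, so in at
      least 13 positions; the first number from 13 on congruent to 41 modulo 8 is 17.\<close>
    have "int (card (- {x. odd (word a x)})) \<le> ip V V"
      using a by (intro ip_ge_card) (metis ComplD even_add even_zero mem_Collect_eq)
    moreover have "card (- {x. odd (word a x)}) = 41 - card {x. odd (word a x)}"
      by (simp add: Compl_eq_Diff_UNIV card_Diff_subset dim)
    ultimately have "13 \<le> ip V V"
      using weight[of a] by linarith
    moreover have "8 dvd ip V V - 41"
      using characteristic_norm[OF V(1)] by (simp add: dim)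
    ultimately have "17 \<le> ip V V"
      by presburger
    then show "17 / 4 \<le> m"
      by (simp add: V(2))
  qed
  then show ?thesis
    by (simp add: sigma_shadow_def)
qed

end

section \<open>A code of length 41\<close>

text \<open>Modulo \<open>2\<close> the rows generate a doubly even \<open>[41, 9]\<close> code with weights \<open>16, 20, 24, 28\<close> and
  dual distance \<open>4\<close>, found by a computer search among codes with an automorphism of order \<open>5\<close>.
  The entries \<open>2\<close> and \<open>3\<close> come from adding multiples of \<open>2\<close> to make the rows orthogonal
  modulo \<open>4\<close>.\<close>

definition code_rows :: "int list list" where
  "code_rows =
   [[1,0,0,0,0,0,0,0,0,1,0,1,0,0,1,0,0,0,1,0,1,0,0,1,0,0,1,1,0,0,1,0,1,0,1,1,1,1,0,0,1],
    [0,1,0,0,0,0,0,0,0,3,2,1,1,0,1,1,1,0,1,3,1,0,0,1,1,0,1,0,1,0,0,1,1,1,1,1,0,0,1,0,0],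
    [0,0,1,0,0,0,0,0,0,1,0,0,1,1,1,1,1,1,1,1,0,1,1,0,0,0,1,0,0,1,1,1,1,0,1,0,1,0,1,0,0],
    [0,0,0,1,0,0,0,0,0,1,0,0,0,1,0,1,0,1,0,1,0,2,1,0,0,1,1,0,0,0,0,1,0,1,1,1,1,2,0,1,1],
    [0,0,0,0,1,0,0,0,0,2,1,1,1,1,1,0,0,0,0,1,1,0,1,0,1,0,1,0,0,1,1,1,0,0,0,1,0,0,1,0,0],
    [0,0,0,0,0,1,0,0,0,0,1,1,2,0,0,1,1,0,2,1,0,1,0,0,0,1,1,1,0,1,0,1,0,1,1,0,0,1,0,0,1],
    [0,0,0,0,0,0,1,0,0,2,3,0,0,1,1,0,0,1,0,3,0,0,0,0,1,1,0,1,1,1,0,1,1,0,1,1,0,0,0,0,1],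
    [0,0,0,0,0,0,0,1,0,2,1,1,1,1,0,1,0,0,1,1,0,1,0,1,0,1,0,0,1,0,1,0,0,0,1,2,2,1,0,1,0],
    [0,0,0,0,0,0,0,0,1,0,2,0,0,0,0,0,0,0,0,0,0,1,1,1,1,0,0,0,0,0,1,1,1,1,1,1,1,1,1,1,1]]"

text \<open>The 17 nonzero entries are units, placed where the sum of rows 3, 6 and 7 (counted from
  0) is even.\<close>

definition short_char :: "int list" where
  "short_char =
    [1,1,1,0,1,1,0,0,1,0,1,0,0,0,0,1,1,-1,0,0,-1,0,0,0,0,0,0,0,-1,0,0,1,0,0,0,1,0,0,-1,-1,-1]"

section \<open>Finite checks on lists\<close>

definition dot :: "int list \<Rightarrow> int list \<Rightarrow> int" where
  "dot u v = sum_list (map2 (*) u v)"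

primrec binary_span :: "bool list list \<Rightarrow> bool list list" where
  "binary_span [] = [replicate 41 False]"
| "binary_span (r # rs) = (let ws = binary_span rs in ws @ map (map2 (\<noteq>) r) ws)"

text \<open>Columns of the generator matrix modulo 2. If they are distinct and nonzero and no two
  add up to a third, the dual distance is at least 4.\<close>

definition code_columns :: "bool list list" where
  "code_columns = map (\<lambda>j. map (\<lambda>r. odd (r ! j)) code_rows) [0..<41]"

lemma code_rows_length: "length code_rows = 9" "\<forall>r\<in>set code_rows. length r = 41"
  by (simp_all add: code_rows_def)

lemma code_rows_orth: "\<forall>u\<in>set code_rows. \<forall>v\<in>set code_rows. 4 dvd dot u v"
  by code_simp

lemma code_rows_info: "\<forall>i\<in>set [0..<9]. \<forall>j\<in>set [0..<9]. code_rows ! i ! j = of_bool (i = j)"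
  by code_simp

lemma code_rows_weights:
  "\<forall>w\<in>set (binary_span (map (map odd) code_rows)).
     let c = length (filter id w) in c = 0 \<or> 16 \<le> c \<and> c \<le> 28"
  by code_simp

lemma code_columns_distinct: "distinct code_columns"
  by code_simp

lemma code_columns_nonzero: "replicate 9 False \<notin> set code_columns"
  by code_simp

lemma code_columns_cap: "\<forall>u\<in>set code_columns. \<forall>v\<in>set code_columns. map2 (\<noteq>) u v \<notin> set code_columns"
  by code_simp

lemma short_char_length: "length short_char = 41"
  by (simp add: short_char_def)

lemma short_char_parity:
  "\<forall>j\<in>set [0..<41]. odd (short_char ! j + (code_rows ! 3 ! j + code_rows ! 6 ! j + code_rows ! 7 ! j))"
  by code_simp

lemma short_char_rows: "\<forall>r\<in>set code_rows. 8 dvd 2 * dot short_char r - dot r r"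
  by code_simp

lemma short_char_norm: "dot short_char short_char = 17"
  by code_simp

text \<open>Extends the enumeration to arbitrary integer coefficients: modulo 2, a row is added or
  left out according to the parity of its coefficient.\<close>

lemma binary_span_word:
  assumes "\<forall>r\<in>set rs. length r = 41"
  shows "map (\<lambda>j. odd (\<Sum>i<length rs. a i * rs ! i ! j)) [0..<41]
           \<in> set (binary_span (map (map odd) rs))"
  using assms
proof (induction rs arbitrary: a)
  case Nil
  then show ?case
    by (simp add: map_replicate_const)
next
  case (Cons r rs)
  define w where "w = map (\<lambda>j. odd (\<Sum>i<length rs. a (Suc i) * rs ! i ! j)) [0..<41]"
  have w: "w \<in> set (binary_span (map (map odd) rs))"
    unfolding w_def using Cons by auto
  have "map (\<lambda>j. odd (\<Sum>i<length (r # rs). a i * (r # rs) ! i ! j)) [0..<41]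
      = (if even (a 0) then w else map2 (\<noteq>) (map odd r) w)"
    using Cons.prems by (intro nth_equalityI) (auto simp: w_def sum.lessThan_Suc_shift simp del: sum.lessThan_Suc)
  then show ?case
    using w by (auto simp: Let_def)
qed

section \<open>Transfer from list positions to the index type \<open>41\<close>\<close>

context
  fixes e :: "41 \<Rightarrow> nat"
  assumes e: "bij_betw e UNIV {..<41}"
begin

definition gen :: "nat \<Rightarrow> 41 \<Rightarrow> int" where
  "gen i x = code_rows ! i ! e x"

definition pos :: "nat \<Rightarrow> 41" where
  "pos = inv_into UNIV e"

lemma e_less: "e x < 41"
  using e by (auto simp: bij_betw_def)

lemma e_pos: "j < 41 \<Longrightarrow> e (pos j) = j"
  using e by (simp add: pos_def bij_betw_inv_into_right)

lemma e_eq_iff: "e x = e y \<longleftrightarrow> x = y"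
  using e by (auto simp: bij_betw_def inj_eq)

lemma row_in_rows: "i < 9 \<Longrightarrow> code_rows ! i \<in> set code_rows"
  by (simp add: code_rows_length(1))

lemma ip_eq_dot:
  assumes "length u = 41" "length v = 41"
  shows "ip (\<lambda>x. u ! e x) (\<lambda>x. v ! e x) = dot u v"
proof -
  have "ip (\<lambda>x. u ! e x) (\<lambda>x. v ! e x) = (\<Sum>j<41. u ! j * v ! j)"
    unfolding ip_def by (rule sum.reindex_bij_betw[OF e])
  also have "\<dots> = dot u v"
    using assms by (simp add: dot_def sum_list_sum_nth atLeast0LessThan)
  finally show ?thesis .
qed

lemma ip_gen: "i < 9 \<Longrightarrow> j < 9 \<Longrightarrow> ip (gen i) (gen j) = dot (code_rows ! i) (code_rows ! j)"
  unfolding gen_def[abs_def] using code_rows_length(2) row_in_rows by (intro ip_eq_dot) auto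

lemma Z4_code_gen: "Z4_code 9 gen pos"
proof
  fix i j :: nat assume ij: "i < 9" "j < 9"
  then show "4 dvd ip (gen i) (gen j)"
    using code_rows_orth row_in_rows by (auto simp: ip_gen)
  show "gen i (pos j) = of_bool (i = j)"
    using code_rows_info ij by (simp add: gen_def e_pos)
qed

interpretation Z4_code 9 gen pos
  by (rule Z4_code_gen)

lemma card_odd_word:
  "card {x. odd (word a x)}
     = length (filter id (map (\<lambda>j. odd (\<Sum>i<9. a i * code_rows ! i ! j)) [0..<41]))"
proof -
  define P where "P j \<longleftrightarrow> odd (\<Sum>i<9. a i * code_rows ! i ! j)" for j
  have "bij_betw e {x. P (e x)} {j \<in> {..<41}. P j}"
    by (rule bij_betw_subset[OF e]) (use e e_pos e_less in \<open>auto simp: image_iff, metis\<close>)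
  then have "card {x. P (e x)} = card {j \<in> {..<41}. P j}"
    by (rule bij_betw_same_card)
  also have "{j \<in> {..<41}. P j} = {j. j < length (map P [0..<41]) \<and> id (map P [0..<41] ! j)}"
    by auto
  finally show ?thesis
    by (simp add: length_filter_conv_card P_def[abs_def] word_def gen_def)
qed

lemma word_weight:
  "card {x. odd (word a x)} = 0 \<or> card {x. odd (word a x)} \<in> {16..28}"
  using code_rows_weights binary_span_word[OF code_rows_length(2), of a]
  unfolding card_odd_word code_rows_length(1) Let_def atLeastAtMost_iff by blast

lemma word_weight_ge:
  assumes "i < 9" "odd (a i)"
  shows "16 \<le> card {x. odd (word a x)}"
proof -
  \<comment> \<open>At the information position \<open>pos i\<close> the word equals
    \<open>a i\<close>, which is odd; this excludes weight 0 in \<open>word_weight\<close>.\<close>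
  have "pos i \<in> {x. odd (word a x)}"
    using assms by (simp add: word_info)
  then have "card {x. odd (word a x)} \<noteq> 0"
    by (auto simp: card_eq_0_iff)
  then show ?thesis
    using word_weight[of a] by auto
qed

definition column :: "41 \<Rightarrow> bool list" where
  "column x = map (\<lambda>i. odd (gen i x)) [0..<9]"

lemma code_columns_nth: "code_columns ! e x = column x"
proof -
  have "map (\<lambda>r. odd (r ! e x)) code_rows = map (\<lambda>i. odd (gen i x)) [0..<9]"
    by (rule nth_equalityI) (auto simp: code_rows_length(1) gen_def)
  then show ?thesis
    by (simp add: code_columns_def column_def e_less)
qed

lemma column_in_code_columns: "column x \<in> set code_columns"
  unfolding code_columns_nth[symmetric] using e_less by (intro nth_mem) (simp add: code_columns_def)

lemma column_inj: "column x = column y \<Longrightarrow> x = y"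
  using code_columns_distinct e_less
  by (simp add: distinct_conv_nth e_eq_iff code_columns_def flip: code_columns_nth) (metis e_eq_iff)

text \<open>An even sum over one, two or three positions would give a zero column, two equal
  columns, or a column that is the sum of two others modulo 2; the checks on
  \<open>code_columns\<close> exclude all three.\<close>

lemma dual_distance:
  assumes "S \<noteq> {}" "card S \<le> 3"
  shows "\<exists>i<9. odd (\<Sum>x\<in>S. gen i x)"
proof (rule ccontr)
  assume "\<not> (\<exists>i<9. odd (\<Sum>x\<in>S. gen i x))"
  then have even: "even (\<Sum>x\<in>S. gen i x)" if "i < 9" for i
    using that by blast
  have "card S \<noteq> 0"
    using assms(1) by simp
  with assms(2) consider "card S = 1" | "card S = 2" | "card S = 3"
    by linarith
  then show False
  proof cases
    case 1
    then obtain x where "S = {x}"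
      by (rule card_1_singletonE)
    then have "column x = replicate 9 False"
      using even by (intro nth_equalityI) (auto simp: column_def)
    then show False
      using code_columns_nonzero column_in_code_columns by metis
  next
    case 2
    then obtain x y where "S = {x, y}" "x \<noteq> y"
      by (auto simp: card_2_iff)
    then have "column x = column y"
      using even by (auto simp: column_def)
    then show False
      using column_inj \<open>x \<noteq> y\<close> by blast
  next
    case 3
    then obtain x y z where "S = {x, y, z}" "x \<noteq> y" "x \<noteq> z" "y \<noteq> z"
      by (auto simp: card_3_iff)
    then have "map2 (\<noteq>) (column x) (column y) = column z"
      using even by (intro nth_equalityI) (auto simp: column_def)
    then show False
      using code_columns_cap column_in_code_columns by metis
  qed
qed

lemma characteristic_short: "characteristic (\<lambda>x. short_char ! e x)"
proof (rule characteristicI)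
  show "odd (short_char ! e x + word (\<lambda>i. of_bool (i \<in> {3, 6, 7})) x)" for x
  proof -
    have "word (\<lambda>i. of_bool (i \<in> {3, 6, 7})) x = (\<Sum>i\<in>{3, 6, 7}. gen i x)"
      unfolding word_def by (rule sum.mono_neutral_cong_right) auto
    also have "\<dots> = code_rows ! 3 ! e x + code_rows ! 6 ! e x + code_rows ! 7 ! e x"
      by (simp add: gen_def)
    finally show ?thesis
      using bspec[OF short_char_parity, of "e x"] e_less[of x] by simp
  qed
next
  fix i :: nat assume "i < 9"
  then have "code_rows ! i \<in> set code_rows" "length (code_rows ! i) = 41"
    using row_in_rows code_rows_length(2) by auto
  then show "8 dvd 2 * ip (\<lambda>x. short_char ! e x) (gen i) - ip (gen i) (gen i)"
    unfolding gen_def[abs_def]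
    using short_char_rows by (simp add: ip_eq_dot short_char_length)
qed

lemma lattice_41:
  "unimodular_lattice lattice \<and> min_norm lattice = 4 \<and> sigma_shadow lattice = 17"
proof (intro conjI)
  show "unimodular_lattice lattice"
    by (rule unimodular)
  show "min_norm lattice = 4"
    using word_weight_ge dual_distance by (intro min_norm_lattice) blast+
  have "card {x. odd (word a x)} \<le> 28" for a
    using word_weight[of a] by auto
  moreover have "ip (\<lambda>x. short_char ! e x) (\<lambda>x. short_char ! e x) = 17"
    using ip_eq_dot[OF short_char_length short_char_length] short_char_norm by (rule trans)
  ultimately show "sigma_shadow lattice = 17"
    using characteristic_short by (intro sigma_shadow_lattice) simp_all
qed

end

theorem proposition4p4:
  "\<exists>L :: (real ^ 41) set. unimodular_lattice L \<and> min_norm L = 4 \<and> sigma_shadow L = 17"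
proof -
  obtain e :: "41 \<Rightarrow> nat" where "bij_betw e UNIV {..<41}"
    using ex_bij_betw_finite_nat[of "UNIV :: 41 set"] by (auto simp: atLeast0LessThan)
  then show ?thesis
    using lattice_41 by blast
qed

end
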